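(* Let $1\le p<\infty$, let $K$ be a compact Hausdorff space, let $X,Y$ be Banach spaces, and let $m\leftrightarrow T:C(K,X)\to Y$ be an operator such that (a) $m$ is strongly bounded and admits a discrete control measure $\lambda$; (b) for every $A\in\Sigma$, $m(A):X\to Y$ is limited completely continuous (respectively limited $p$-convergent). Then $T$ is limited completely continuous (respectively limited $p$-convergent).
   Context: Operator means bounded linear map. $C(K,X)$ is the space of continuous functions $K\to X$ with the sup norm; $\Sigma$ is the Borel $\sigma$-algebra of $K$. Its dual is $rcabv(\Sigma,X^* )$, the regular countably additive $X^*$-valued Borel measures of bounded variation. Every operator $T:C(K,X)\to Y$ has a representing measure $m:\Sigma\to L(X,Y^{**})$ (written $m\leftrightarrow T$), $m(A)x=T^{**}(\chi_A x)$, where $\chi_A x\in C(K,X)^{**}$ acts on $\mu\in rcabv(\Sigma,X^* )$ by $\langle \mu(A),x\rangle$; one has $T(f)=\int_K f\,dm$. For $y^*\in Y^*$ put $y^*m=T^*(y^* )\in rcabv(\Sigma,X^* )$, so $\langle y^*m(A),x\rangle=\langle m(A)x,y^*\rangle$. The semivariation is $\tilde m(E)=\sup\{|y^*m|(E): \|y^*\|\le 1\}$, with $|\cdot|$ denoting variation. $T$ (or $m$) is strongly bounded if $\tilde m(A_i)\to 0$ for every decreasing sequence $(A_i)$ in $\Sigma$ with empty intersection; in that case $m$ takes values in $L(X,Y)$. A control measure for $m$ is a non-negative (finite) regular Borel measure $\lambda$ on $K$ such that $\tilde m(A)\to0$ as $\lambda(A)\to0$. A positive Radon measure is discrete if every set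 of positive measure contains an atom; in this case it is of the form $\sum_i a_i\delta_{t_i}$ (countable sum) with $\sum_i|a_i|<\infty$. A bounded subset $A$ of a Banach space $E$ is limited if $\sup_{x\in A}|x_n^*(x)|\to 0$ for every $w^*$-null sequence $(x_n^* )$ in $E^*$. A sequence $(x_n)$ in $E$ is weakly $p$-summable if $(x^*(x_n))\in\ell_p$ for all $x^*\in E^*$. A limited weakly null (resp. limited weakly $p$-summable) sequence is a weakly null (resp. weakly $p$-summable) sequence whose set of terms is limited. An operator is limited completely continuous (resp. limited $p$-convergent) if it maps limited weakly null (resp. limited weakly $p$-summable) sequences to norm null sequences. *)

theory Defs
  imports "HOL-Analysis.Analysis"
begin

type_synonym 'e dual = "'e \<Rightarrow>\<^sub>L real"

text \<open>
  Since the whole space is the compact space under consideration, every continuous function is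
  bounded, and \<open>C(K,X)\<close> is the type of bounded continuous functions with its sup norm.
  All set functions below live on \<^term>\<open>sets borel\<close>; their values elsewhere are irrelevant.
\<close>


section \<open>Vector measures\<close>

definition variation ::
  "('k::topological_space set \<Rightarrow> 'z::real_normed_vector) \<Rightarrow> 'k set \<Rightarrow> ennreal" where
  "variation \<mu> E =
     (SUP P \<in> {P. finite P \<and> P \<subseteq> sets borel \<and> disjoint P \<and> \<Union>P = E}. \<Sum>A\<in>P. ennreal (norm (\<mu> A)))"

definition regular_set_fun :: "('k::topological_space set \<Rightarrow> ennreal) \<Rightarrow> bool" where
  "regular_set_fun \<nu> \<longleftrightarrow>
     (\<forall>A\<in>sets borel. \<forall>e>0. \<exists>F U. compact F \<and> open U \<and> F \<subseteq> A \<and> A \<subseteq> U \<and> \<nu> (U - F) < e)"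

definition rcabv :: "('k::topological_space set \<Rightarrow> 'z::real_normed_vector) \<Rightarrow> bool" where
  "rcabv \<mu> \<longleftrightarrow>
     (\<forall>A :: nat \<Rightarrow> 'k set. range A \<subseteq> sets borel \<longrightarrow> disjoint_family A \<longrightarrow>
        (\<lambda>n. \<mu> (A n)) sums \<mu> (\<Union>n. A n)) \<and>
     variation \<mu> UNIV < \<infinity> \<and>
     regular_set_fun (variation \<mu>)"

definition simple_borel :: "('k::topological_space \<Rightarrow> 'x) \<Rightarrow> bool" where
  "simple_borel s \<longleftrightarrow> finite (range s) \<and> (\<forall>v. s -` {v} \<in> sets borel)"

definition simple_vint ::
  "('k::topological_space set \<Rightarrow> 'x::real_normed_vector \<Rightarrow>\<^sub>L 'z::real_normed_vector) \<Rightarrow>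
   ('k \<Rightarrow> 'x) \<Rightarrow> 'z" where
  "simple_vint \<mu> s = (\<Sum>v\<in>range s. \<mu> (s -` {v}) v)"

text \<open>
  The integral of a uniform limit of simple functions is the limit of their integrals; for measures
  of bounded variation (the only ones it is used for) it does not depend on the approximating
  sequence, since \<open>\<parallel>\<integral>s d\<mu>\<parallel> \<le> |\<mu>|(K) sup \<parallel>s\<parallel>\<close> for simple \<open>s\<close>.
\<close>

definition has_vint ::
  "('k::topological_space set \<Rightarrow> 'x::real_normed_vector \<Rightarrow>\<^sub>L 'z::real_normed_vector) \<Rightarrow>
   ('k \<Rightarrow> 'x) \<Rightarrow> 'z \<Rightarrow> bool" where
  "has_vint \<mu> f I \<longleftrightarrow>
     (\<exists>s :: nat \<Rightarrow> 'k \<Rightarrow> 'x. (\<forall>n. simple_borel (s n)) \<and> uniform_limit UNIV s f sequentially \<and>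
        (\<lambda>n. simple_vint \<mu> (s n)) \<longlonglongrightarrow> I)"

text \<open>The identification of \<open>C(K,X)\<^sup>*\<close> with \<open>rcabv(\<Sigma>, X\<^sup>*)\<close>.\<close>

definition represents_functional ::
  "('k::topological_space set \<Rightarrow> 'x::real_normed_vector dual) \<Rightarrow> ('k \<Rightarrow>\<^sub>C 'x) dual \<Rightarrow> bool" where
  "represents_functional \<mu> \<phi> \<longleftrightarrow> rcabv \<mu> \<and> (\<forall>f. has_vint \<mu> (apply_bcontfun f) (\<phi> f))"


section \<open>Representing measures\<close>

definition functional_measure ::
  "'y::real_normed_vector dual \<Rightarrow> ('k set \<Rightarrow> 'x::real_normed_vector \<Rightarrow>\<^sub>L 'y dual dual) \<Rightarrow>
   'k set \<Rightarrow> 'x dual" where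
  "functional_measure ystar m A = Blinfun (\<lambda>x. m A x ystar)"

lemma functional_measure_apply [simp]: "functional_measure ystar m A x = m A x ystar"
proof -
  have "bounded_linear (\<lambda>x. m A x ystar)"
    by (rule bounded_linear_compose[OF blinfun.bounded_linear_left blinfun.bounded_linear_right])
  then show ?thesis
    by (simp add: functional_measure_def bounded_linear_Blinfun_apply)
qed

text \<open>
  \<open>T\<^sup>*(y\<^sup>*)\<close> is the functional \<open>y\<^sup>* \<circ> T\<close>.  If \<open>\<mu>\<close> is the measure representing it, then
  \<open>m(A)x = T\<^sup>*\<^sup>*(\<chi>\<^sub>A x)\<close> evaluated at \<open>y\<^sup>*\<close> reads \<open>\<langle>m(A)x, y\<^sup>*\<rangle> = \<langle>\<mu>(A), x\<rangle>\<close>, that is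
  \<open>\<mu> = y\<^sup>*m\<close>.
\<close>

definition representing_measure ::
  "('k::topological_space set \<Rightarrow> 'x::real_normed_vector \<Rightarrow>\<^sub>L 'y::real_normed_vector dual dual) \<Rightarrow>
   (('k \<Rightarrow>\<^sub>C 'x) \<Rightarrow>\<^sub>L 'y) \<Rightarrow> bool" where
  "representing_measure m T \<longleftrightarrow>
     (\<forall>ystar. represents_functional (functional_measure ystar m) (ystar o\<^sub>L T))"

definition semivariation ::
  "('k::topological_space set \<Rightarrow> 'x::real_normed_vector \<Rightarrow>\<^sub>L 'y::real_normed_vector dual dual) \<Rightarrow>
   'k set \<Rightarrow> ennreal" where
  "semivariation m E =
     (SUP ystar \<in> {ystar. norm ystar \<le> 1}. variation (functional_measure ystar m) E)"

definition strongly_bounded ::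
  "('k::topological_space set \<Rightarrow> 'x::real_normed_vector \<Rightarrow>\<^sub>L 'y::real_normed_vector dual dual) \<Rightarrow>
   bool" where
  "strongly_bounded m \<longleftrightarrow>
     (\<forall>A :: nat \<Rightarrow> 'k set. range A \<subseteq> sets borel \<longrightarrow> decseq A \<longrightarrow> (\<Inter>n. A n) = {} \<longrightarrow>
        (\<lambda>n. semivariation m (A n)) \<longlonglongrightarrow> 0)"

definition bidual_embed :: "'y::real_normed_vector \<Rightarrow> 'y dual dual" where
  "bidual_embed y = Blinfun (\<lambda>ystar. blinfun_apply ystar y)"

lemma bidual_embed_apply [simp]: "bidual_embed y ystar = ystar y"
  by (simp add: bidual_embed_def bounded_linear_Blinfun_apply blinfun.bounded_linear_left)


section \<open>Control measures\<close>

definition regular_borel_measure :: "'k::topological_space measure \<Rightarrow> bool" where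
  "regular_borel_measure \<nu> \<longleftrightarrow>
     sets \<nu> = sets borel \<and> finite_measure \<nu> \<and> regular_set_fun (emeasure \<nu>)"

definition control_measure ::
  "'k::topological_space measure \<Rightarrow>
   ('k set \<Rightarrow> 'x::real_normed_vector \<Rightarrow>\<^sub>L 'y::real_normed_vector dual dual) \<Rightarrow> bool" where
  "control_measure \<nu> m \<longleftrightarrow>
     regular_borel_measure \<nu> \<and>
     (\<forall>e>0. \<exists>d>0. \<forall>A\<in>sets borel. emeasure \<nu> A < d \<longrightarrow> semivariation m A < e)"

definition measure_atom :: "'k measure \<Rightarrow> 'k set \<Rightarrow> bool" where
  "measure_atom \<nu> B \<longleftrightarrow>
     B \<in> sets \<nu> \<and> emeasure \<nu> B > 0 \<and>
     (\<forall>C\<in>sets \<nu>. C \<subseteq> B \<longrightarrow> emeasure \<nu> C = 0 \<or> emeasure \<nu> C = emeasure \<nu> B)"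

definition discrete_measure :: "'k measure \<Rightarrow> bool" where
  "discrete_measure \<nu> \<longleftrightarrow>
     (\<forall>A\<in>sets \<nu>. emeasure \<nu> A > 0 \<longrightarrow> (\<exists>B. B \<subseteq> A \<and> measure_atom \<nu> B))"


section \<open>Limited sets and classes of operators\<close>

text \<open>The supremum is taken in \<^typ>\<open>ennreal\<close>, where it is also meaningful for the empty set.\<close>

definition limited_set :: "'e::real_normed_vector set \<Rightarrow> bool" where
  "limited_set A \<longleftrightarrow>
     bounded A \<and>
     (\<forall>xstar :: nat \<Rightarrow> 'e dual. (\<forall>x. (\<lambda>n. xstar n x) \<longlonglongrightarrow> 0) \<longrightarrow>
        (\<lambda>n. SUP x\<in>A. ennreal \<bar>xstar n x\<bar>) \<longlonglongrightarrow> 0)"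

definition weakly_null :: "(nat \<Rightarrow> 'e::real_normed_vector) \<Rightarrow> bool" where
  "weakly_null x \<longleftrightarrow> (\<forall>xstar :: 'e dual. (\<lambda>n. xstar (x n)) \<longlonglongrightarrow> 0)"

definition weakly_summable :: "real \<Rightarrow> (nat \<Rightarrow> 'e::real_normed_vector) \<Rightarrow> bool" where
  "weakly_summable p x \<longleftrightarrow> (\<forall>xstar :: 'e dual. summable (\<lambda>n. \<bar>xstar (x n)\<bar> powr p))"

definition limited_completely_continuous ::
  "('e::real_normed_vector \<Rightarrow>\<^sub>L 'f::real_normed_vector) \<Rightarrow> bool" where
  "limited_completely_continuous T \<longleftrightarrow>
     (\<forall>x. weakly_null x \<longrightarrow> limited_set (range x) \<longrightarrow> (\<lambda>n. T (x n)) \<longlonglongrightarrow> 0)"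

definition limited_p_convergent ::
  "real \<Rightarrow> ('e::real_normed_vector \<Rightarrow>\<^sub>L 'f::real_normed_vector) \<Rightarrow> bool" where
  "limited_p_convergent p T \<longleftrightarrow>
     (\<forall>x. weakly_summable p x \<longrightarrow> limited_set (range x) \<longrightarrow> (\<lambda>n. T (x n)) \<longlonglongrightarrow> 0)"

text \<open>
  \<open>value_operator m A S\<close> says that \<open>m(A)\<close>, a priori an operator into the bidual, is the operator
  \<open>S\<close> into the space itself; such an \<open>S\<close> is unique, and exists if \<open>m\<close> is strongly bounded.
\<close>

definition value_operator ::
  "('k set \<Rightarrow> 'x::real_normed_vector \<Rightarrow>\<^sub>L 'y::real_normed_vector dual dual) \<Rightarrow> 'k set \<Rightarrow>
   ('x \<Rightarrow>\<^sub>L 'y) \<Rightarrow> bool" where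
  "value_operator m A S \<longleftrightarrow> (\<forall>x. m A x = bidual_embed (S x))"

end

theory Submission
  imports Defs
begin

text \<open>
  By regularity an atom of the control measure contains a point of positive mass, so a discrete
  control measure lives on countably many points, and the semivariation of \<open>m\<close> is small off some
  finite set \<open>F\<close>.  Up to this small error times \<open>\<parallel>f\<parallel>\<close>, \<open>T(f)\<close> is the sum of \<open>m({t}) f(t)\<close> over
  \<open>t \<in> F\<close>.  Evaluation at a point is an operator, hence sends limited weakly null (weakly
  \<open>p\<close>-summable) sequences to such sequences, and each of the finitely many summands tends to zero
  by the hypothesis on \<open>m({t})\<close>.  A bound on all \<open>y\<^sup>*(T(f))\<close> becomes one on \<open>\<parallel>T(f)\<parallel>\<close> by the
  Hahn-Banach theorem.
\<close>

section \<open>Norming functionals\<close>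

definition sublinear :: "('a::real_vector \<Rightarrow> real) \<Rightarrow> bool" where
  "sublinear q \<longleftrightarrow>
     (\<forall>x y. q (x + y) \<le> q x + q y) \<and> (\<forall>c x. 0 \<le> c \<longrightarrow> q (c *\<^sub>R x) = c * q x)"

lemma sublinear_add: "sublinear q \<Longrightarrow> q (x + y) \<le> q x + q y"
  and sublinear_scale: "sublinear q \<Longrightarrow> 0 \<le> c \<Longrightarrow> q (c *\<^sub>R x) = c * q x"
  by (auto simp: sublinear_def)

lemma sublinear_zero: "sublinear q \<Longrightarrow> q 0 = 0"
  using sublinear_scale[of q 0 0] by simp

lemma sublinear_minus: "sublinear q \<Longrightarrow> - q (- x) \<le> q x"
  using sublinear_add[of q x "- x"] sublinear_zero[of q] by simp

lemma sublinear_norm: "sublinear (norm :: 'a::real_normed_vector \<Rightarrow> real)"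
  by (auto simp: sublinear_def norm_triangle_ineq)

text \<open>For sublinear \<open>q\<close> this is the largest sublinear functional below
  \<open>q\<close> whose value at \<open>- z\<close> is at most \<open>- q z\<close>:
  \<open>t = 0\<close> keeps it below \<open>q\<close>, and \<open>t = 1\<close> bounds the value at
  \<open>- z\<close>.\<close>

definition tilt :: "('a::real_vector \<Rightarrow> real) \<Rightarrow> 'a \<Rightarrow> 'a \<Rightarrow> real" where
  "tilt q z x = (INF t\<in>{0..}. q (x + t *\<^sub>R z) - t * q z)"

lemma tilt_le:
  assumes "sublinear q" "0 \<le> t"
  shows "tilt q z x \<le> q (x + t *\<^sub>R z) - t * q z"
  unfolding tilt_def
proof (rule cINF_lower)
  \<comment> \<open>A real infimum needs a lower bound. Subadditivity bounds \<open>t * q z\<close>,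
    the value of \<open>q\<close> at \<open>t *\<^sub>R z\<close>, by
    \<open>q (x + t *\<^sub>R z) + q (- x)\<close>.\<close>
  show "bdd_below ((\<lambda>t. q (x + t *\<^sub>R z) - t * q z) ` {0..})"
  proof (rule bdd_belowI2)
    fix s :: real assume "s \<in> {0..}"
    then show "- q (- x) \<le> q (x + s *\<^sub>R z) - s * q z"
      using sublinear_add[OF assms(1), of "x + s *\<^sub>R z" "- x"] sublinear_scale[OF assms(1), of s z]
      by simp
  qed
qed (use assms in auto)

lemma tilt_greatest:
  "(\<And>t. 0 \<le> t \<Longrightarrow> b \<le> q (x + t *\<^sub>R z) - t * q z) \<Longrightarrow> b \<le> tilt q z x"
  unfolding tilt_def by (rule cINF_greatest) auto

lemma sublinear_tilt:
  assumes q: "sublinear q"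
  shows "sublinear (tilt q z)"
proof -
  have add: "tilt q z (x + y) \<le> tilt q z x + tilt q z y" for x y
  proof -
    \<comment> \<open>The parameters add up: \<open>s\<close> for \<open>x\<close> and
      \<open>t\<close> for \<open>y\<close> give \<open>s + t\<close> for \<open>x + y\<close>. The
      two infima are then taken one after the other.\<close>
    have "tilt q z (x + y) \<le> (q (x + s *\<^sub>R z) - s * q z) + (q (y + t *\<^sub>R z) - t * q z)"
      if "0 \<le> s" "0 \<le> t" for s t
      using tilt_le[OF q, of "s + t" z "x + y"] that
        sublinear_add[OF q, of "x + s *\<^sub>R z" "y + t *\<^sub>R z"]
      by (simp add: algebra_simps)
    then have "tilt q z (x + y) - (q (x + s *\<^sub>R z) - s * q z) \<le> tilt q z y" if "0 \<le> s" for s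
      using that by (intro tilt_greatest) (smt (verit))
    then have "tilt q z (x + y) - tilt q z y \<le> tilt q z x"
      by (intro tilt_greatest) (smt (verit))
    then show ?thesis by simp
  qed
  \<comment> \<open>One inequality for all \<open>c > 0\<close> suffices, since
    \<open>inverse c\<close> and \<open>c *\<^sub>R x\<close> give the converse. It comes from
    replacing \<open>t\<close> by \<open>c * t\<close>.\<close>
  have le: "tilt q z (c *\<^sub>R x) \<le> c * tilt q z x" if "0 < c" for c x
  proof -
    have "tilt q z (c *\<^sub>R x) / c \<le> tilt q z x"
    proof (rule tilt_greatest)
      fix t :: real assume "0 \<le> t"
      then have "tilt q z (c *\<^sub>R x) \<le> q (c *\<^sub>R (x + t *\<^sub>R z)) - c * t * q z"
        using tilt_le[OF q, of "c * t" z "c *\<^sub>R x"] that by (simp add: algebra_simps)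
      also have "\<dots> = c * (q (x + t *\<^sub>R z) - t * q z)"
        using sublinear_scale[OF q, of c "x + t *\<^sub>R z"] that
        by (simp add: right_diff_distrib mult.assoc)
      finally show "tilt q z (c *\<^sub>R x) / c \<le> q (x + t *\<^sub>R z) - t * q z"
        using that by (simp add: field_simps)
    qed
    then show ?thesis
      using that by (simp add: field_simps)
  qed
  have zero: "tilt q z 0 = 0"
    using tilt_le[OF q, of 0 z 0] sublinear_zero[OF q]
    by (auto intro!: antisym tilt_greatest simp: sublinear_scale[OF q])
  have "tilt q z (c *\<^sub>R x) = c * tilt q z x" if "0 \<le> c" for c x
  proof (cases "c = 0")
    case False
    then have "0 < c" using that by simp
    then show ?thesis
      using le[of c x] le[of "inverse c" "c *\<^sub>R x"] by (simp add: field_simps)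
  qed (simp add: zero)
  then show ?thesis
    using add by (simp add: sublinear_def)
qed

text \<open>Supplies the lower bounds for Zorn's lemma. The common majorant \<open>p\<close> keeps
  the infimum finite, as \<open>- p (- x) \<le> - r (- x) \<le> r x\<close>; comparability of the
  members gives subadditivity.\<close>

lemma sublinear_INF_chain:
  fixes C :: "('a::real_vector \<Rightarrow> real) set"
  assumes "C \<noteq> {}" and sub: "\<And>q. q \<in> C \<Longrightarrow> sublinear q" and le: "\<And>q. q \<in> C \<Longrightarrow> q \<le> p"
    and chain: "\<And>q r. q \<in> C \<Longrightarrow> r \<in> C \<Longrightarrow> q \<le> r \<or> r \<le> q"
  defines "u \<equiv> \<lambda>x. INF q\<in>C. q x"
  shows "sublinear u" and "\<And>q. q \<in> C \<Longrightarrow> u \<le> q"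
proof -
  have low: "u x \<le> q x" if "q \<in> C" for q x
    unfolding u_def
  proof (rule cINF_lower[OF _ that])
    show "bdd_below ((\<lambda>q. q x) ` C)"
    proof (rule bdd_belowI2)
      fix r assume "r \<in> C"
      then show "- p (- x) \<le> r x"
        using sublinear_minus[OF sub, of r x] le_funD[OF le, of r "- x"] by simp
    qed
  qed
  have great: "b \<le> u x" if "\<And>q. q \<in> C \<Longrightarrow> b \<le> q x" for b x
    unfolding u_def using that \<open>C \<noteq> {}\<close> by (intro cINF_greatest)
  show "\<And>q. q \<in> C \<Longrightarrow> u \<le> q"
    using low by (auto simp: le_fun_def)
  have "u (x + y) \<le> q x + r y" if qr: "q \<in> C" "r \<in> C" for q r x y
  proof -
    \<comment> \<open>The smaller of \<open>q\<close> and \<open>r\<close> lies below both, so its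
      subadditivity bounds the mixed sum.\<close>
    obtain s where s: "s \<in> C" "s \<le> q" "s \<le> r"
      using chain[OF qr] qr by blast
    have "u (x + y) \<le> s x + s y"
      using low[OF s(1), of "x + y"] sublinear_add[OF sub[OF s(1)], of x y] by simp
    then show ?thesis
      using s(2,3) le_funD[OF s(2), of x] le_funD[OF s(3), of y] by simp
  qed
  then have "u (x + y) - q x \<le> u y" if "q \<in> C" for q x y
    using that by (intro great) (smt (verit))
  then have "u (x + y) - u y \<le> u x" for x y
    by (intro great) (smt (verit))
  then have add: "u (x + y) \<le> u x + u y" for x y
    by (simp add: algebra_simps)
  have scale_le: "u (c *\<^sub>R x) \<le> c * u x" if "0 < c" for c x
  proof -
    have "u (c *\<^sub>R x) / c \<le> u x"
    proof (rule great)
      fix q assume "q \<in> C"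
      then show "u (c *\<^sub>R x) / c \<le> q x"
        using low[of q "c *\<^sub>R x"] sublinear_scale[OF sub, of q c x] that by (simp add: field_simps)
    qed
    then show ?thesis using that by (simp add: field_simps)
  qed
  have zero: "u 0 = 0"
    unfolding u_def using \<open>C \<noteq> {}\<close> by (simp add: sublinear_zero sub)
  have "u (c *\<^sub>R x) = c * u x" if "0 \<le> c" for c x
  proof (cases "c = 0")
    case False
    then have "0 < c" using that by simp
    then show ?thesis
      using scale_le[of c x] scale_le[of "inverse c" "c *\<^sub>R x"] by (simp add: field_simps)
  qed (simp add: zero)
  then show "sublinear u"
    using add by (simp add: sublinear_def)
qed

text \<open>Minimal sublinear functionals are linear: a minimal \<open>q\<close> agrees with all of its tilts, and
  \<open>t = 1\<close> in \<^const>\<open>tilt\<close> gives superadditivity.\<close>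

lemma linear_below_sublinear:
  fixes p :: "'a::real_vector \<Rightarrow> real"
  assumes p: "sublinear p"
  obtains f where "linear f" "f \<le> p"
proof -
  define A where "A = {q. sublinear q \<and> q \<le> p}"
  \<comment> \<open>The order is reversed, so Zorn's lemma yields a minimal element of
    \<open>A\<close>.\<close>
  have "\<exists>q\<in>A. \<forall>r\<in>A. r \<le> q \<longrightarrow> r = q"
  proof (rule predicate_Zorn)
    show "partial_order_on A (relation_of (\<lambda>q r. r \<le> q) A)"
      by (rule partial_order_on_relation_ofI) auto
  next
    fix C assume C: "C \<in> Chains (relation_of (\<lambda>q r. r \<le> q) A)"
    then have mem: "q \<in> A" if "q \<in> C" for q
      using that by (auto simp: Chains_def relation_of_def)
    have chain: "q \<le> r \<or> r \<le> q" if "q \<in> C" "r \<in> C" for q r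
      using that C by (auto simp: Chains_def relation_of_def)
    show "\<exists>u\<in>A. \<forall>q\<in>C. u \<le> q"
    \<comment> \<open>For the empty chain \<open>p\<close> itself is the bound; an infimum over an
      empty set of reals carries no information.\<close>
    proof (cases "C = {}")
      case True
      then show ?thesis using p by (auto simp: A_def)
    next
      case False
      let ?u = "\<lambda>x. INF q\<in>C. q x"
      have sub: "q \<in> C \<Longrightarrow> sublinear q" and le: "q \<in> C \<Longrightarrow> q \<le> p" for q
        using mem by (auto simp: A_def)
      have u: "sublinear ?u" "\<And>q. q \<in> C \<Longrightarrow> ?u \<le> q"
        using sublinear_INF_chain[OF False sub le chain] by blast+
      obtain q where "q \<in> C" using False by blast
      then have "?u \<le> p"
        using u(2) le order_trans by blast
      then show ?thesis
        using u unfolding A_def by (intro bexI[of _ ?u]) auto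
    qed
  qed
  then obtain q where q: "sublinear q" "q \<le> p"
    and min: "\<And>r. sublinear r \<Longrightarrow> r \<le> q \<Longrightarrow> r = q"
    unfolding A_def by (auto intro: order_trans)
  \<comment> \<open>Every tilt lies below \<open>q\<close> by \<open>t = 0\<close>, and minimality
    turns this into equality.\<close>
  have "tilt q z = q" for z
    using tilt_le[OF q(1), of 0 z]
    by (intro min sublinear_tilt q(1)) (auto simp: le_fun_def)
  then have add: "q (x + z) = q x + q z" for x z
    using tilt_le[OF q(1), of 1 z x] sublinear_add[OF q(1), of x z] by simp
  then have minus: "q (- x) = - q x" for x
    using add[of x "- x"] sublinear_zero[OF q(1)] by simp
  have "linear q"
  proof (rule linearI)
    fix c :: real and x
    show "q (c *\<^sub>R x) = c *\<^sub>R q x"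
      using sublinear_scale[OF q(1), of c x] sublinear_scale[OF q(1), of "- c" x] minus[of "c *\<^sub>R x"]
      by (cases "0 \<le> c") auto
  qed (rule add)
  then show ?thesis using q(2) that by blast
qed

text \<open>A linear functional below the norm has norm at most 1, as \<open>- x\<close> shows, so
  only the value at \<open>y\<close> has to be forced.\<close>

lemma exists_norming_functional:
  fixes y :: "'y::real_normed_vector"
  obtains \<phi> :: "'y dual" where "norm \<phi> \<le> 1" "\<phi> y = norm y"
proof -
  \<comment> \<open>Tilting the norm along \<open>- y\<close> forces \<open>f y \<le> - \<parallel>y\<parallel>\<close>.\<close>
  obtain f where f: "linear f" "f \<le> tilt norm (- y)"
    using linear_below_sublinear[OF sublinear_tilt[OF sublinear_norm]] by blast
  have le: "f x \<le> norm x" for x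
    using le_funD[OF f(2), of x] tilt_le[OF sublinear_norm, of 0 "- y" x] by simp
  have "\<bar>f x\<bar> \<le> norm x" for x
    using le[of x] le[of "- x"] linear_neg[OF f(1), of x] by simp
  moreover have "f y \<le> - norm y"
    using le_funD[OF f(2), of y] tilt_le[OF sublinear_norm, of 1 "- y" y] by simp
  ultimately have fy: "f y = - norm y"
    by (smt (verit))
  \<comment> \<open>The linear \<open>f\<close> takes the value \<open>- norm y\<close> at
    \<open>y\<close>, hence the change of sign.\<close>
  define \<phi> where "\<phi> = Blinfun (\<lambda>x. - f x)"
  have "bounded_linear (\<lambda>x. - f x)"
    using f(1) \<open>\<And>x. \<bar>f x\<bar> \<le> norm x\<close>
    by (intro bounded_linear_minus bounded_linear_intro[of f 1])
      (auto simp: linear_add linear_scale)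
  then have ap: "\<phi> x = - f x" for x
    by (simp add: \<phi>_def bounded_linear_Blinfun_apply)
  have "norm \<phi> \<le> 1"
    using \<open>\<And>x. \<bar>f x\<bar> \<le> norm x\<close> by (intro norm_blinfun_bound) (auto simp: ap)
  then show ?thesis
    using that[of \<phi>] by (simp add: ap fy)
qed

section \<open>Discrete regular measures\<close>

text \<open>If all points of the atom were null, outer regularity would give each a neighbourhood of
  smaller measure than the atom, which by the dichotomy meets the atom in a null set. Finitely many
  of these cover a compact subset that inner regularity makes non-null, a contradiction.\<close>

lemma atom_contains_point_mass:
  fixes \<nu> :: "'k::t2_space measure"
  assumes reg: "regular_borel_measure \<nu>" and atom: "measure_atom \<nu> B"
  obtains t where "t \<in> B" "emeasure \<nu> {t} > 0"
proof (rule ccontr)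
  assume "\<not> thesis"
  then have zero: "emeasure \<nu> {t} = 0" if "t \<in> B" for t
    using that(1) \<open>\<And>t. t \<in> B \<Longrightarrow> emeasure \<nu> {t} > 0 \<Longrightarrow> thesis\<close>
    by (auto simp: zero_less_iff_neq_zero)
  have sets: "sets \<nu> = sets borel"
    and regular: "\<And>A e. A \<in> sets borel \<Longrightarrow> e > 0 \<Longrightarrow>
      \<exists>F U. compact F \<and> open U \<and> F \<subseteq> A \<and> A \<subseteq> U \<and> emeasure \<nu> (U - F) < e"
    using reg unfolding regular_borel_measure_def regular_set_fun_def by auto
  have B: "B \<in> sets borel" "emeasure \<nu> B > 0"
    and dich: "\<And>C. C \<in> sets borel \<Longrightarrow> C \<subseteq> B \<Longrightarrow> emeasure \<nu> C = 0 \<or> emeasure \<nu> C = emeasure \<nu> B"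
    using atom unfolding measure_atom_def sets by auto
  \<comment> \<open>Used twice: with \<open>A = U\<close> around a single point, and with
    \<open>A = B\<close> for the final contradiction.\<close>
  have small: "emeasure \<nu> A < emeasure \<nu> B"
    if "compact F" "open U" "F \<subseteq> A" "A \<subseteq> U" "A \<in> sets borel" "emeasure \<nu> (U - F) < emeasure \<nu> B"
      "emeasure \<nu> F = 0" for A F U
  proof -
    have F: "F \<in> sets borel" using compact_imp_closed[OF that(1)] by simp
    have "emeasure \<nu> A \<le> emeasure \<nu> (F \<union> (U - F))"
      using that F by (intro emeasure_mono) (auto simp: sets)
    also have "\<dots> \<le> emeasure \<nu> F + emeasure \<nu> (U - F)"
      using that F by (intro emeasure_subadditive) (auto simp: sets)
    finally show ?thesis
      using that by simp
  qed
  have "\<forall>t\<in>B. \<exists>U. open U \<and> t \<in> U \<and> emeasure \<nu> (U \<inter> B) = 0"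
  proof
    fix t assume t: "t \<in> B"
    obtain F U where FU: "compact F" "open U" "F \<subseteq> {t}" "{t} \<subseteq> U" "emeasure \<nu> (U - F) < emeasure \<nu> B"
      using regular[of "{t}", OF _ B(2)] by auto
    have "emeasure \<nu> F = 0"
      using emeasure_mono[OF FU(3), of \<nu>] zero[OF t] by (simp add: sets)
    then have "emeasure \<nu> U < emeasure \<nu> B"
      using FU by (intro small[of F U U]) auto
    moreover have "emeasure \<nu> (U \<inter> B) \<le> emeasure \<nu> U"
      using FU by (intro emeasure_mono) (auto simp: sets)
    ultimately show "\<exists>U. open U \<and> t \<in> U \<and> emeasure \<nu> (U \<inter> B) = 0"
      using dich[of "U \<inter> B"] FU(2,4) B(1) by (intro exI[of _ U]) auto
  qed
  then obtain V where "\<forall>t\<in>B. open (V t) \<and> t \<in> V t \<and> emeasure \<nu> (V t \<inter> B) = 0"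
    by (rule bchoice[THEN exE])
  then have V: "\<And>t. t \<in> B \<Longrightarrow> open (V t)" "\<And>t. t \<in> B \<Longrightarrow> t \<in> V t"
    "\<And>t. t \<in> B \<Longrightarrow> emeasure \<nu> (V t \<inter> B) = 0"
    by simp_all
  obtain F U where FU: "compact F" "open U" "F \<subseteq> B" "B \<subseteq> U" "emeasure \<nu> (U - F) < emeasure \<nu> B"
    using regular[OF B] by auto
  obtain C where C: "C \<subseteq> F" "finite C" "F \<subseteq> (\<Union>t\<in>C. V t)"
  proof (rule compactE_image[OF FU(1), of F V])
    show "open (V t)" if "t \<in> F" for t
      using that FU(3) V(1) by blast
    show "F \<subseteq> (\<Union>t\<in>F. V t)"
      using FU(3) V(2) by blast
  qed
  have "(\<Union>t\<in>C. V t \<inter> B) \<in> null_sets \<nu>"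
    using C FU(3) V B by (intro null_sets.finite_UN) (auto simp: sets null_sets_def)
  moreover have "F \<subseteq> (\<Union>t\<in>C. V t \<inter> B)"
    using C FU(3) by auto
  ultimately have "emeasure \<nu> F = 0"
    using emeasure_eq_0[of _ \<nu> F] by (blast dest: null_setsD1 null_setsD2)
  then show False
    using small[of F U B] FU B by auto
qed

text \<open>The complement of the point masses contains no atom, so discreteness makes it null.
  Removing more and more of the countably many point masses then leaves arbitrarily little.\<close>

lemma discrete_measure_cofinite_small:
  fixes \<nu> :: "'k::t2_space measure"
  assumes reg: "regular_borel_measure \<nu>" and discrete: "discrete_measure \<nu>" and "0 < d"
  obtains F where "finite F" "emeasure \<nu> (UNIV - F) < d"
proof -
  have sets: "sets \<nu> = sets borel"
    using reg unfolding regular_borel_measure_def by auto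
  then have space: "space \<nu> = UNIV"
    using sets_eq_imp_space_eq[of \<nu> borel] by simp
  interpret finite_measure \<nu>
    using reg unfolding regular_borel_measure_def by auto
  define D where "D = {t. measure \<nu> {t} \<noteq> 0}"
  have "countable D"
    unfolding D_def by (rule countable_support)
  have borel: "A \<in> sets borel" if "A \<subseteq> D" for A
  proof -
    have "countable A" using that \<open>countable D\<close> countable_subset by blast
    then show ?thesis by (rule sets.countable[rotated]) auto
  qed
  have null: "emeasure \<nu> (UNIV - D) = 0"
  proof (rule ccontr)
    assume "emeasure \<nu> (UNIV - D) \<noteq> 0"
    moreover have "UNIV - D \<in> sets \<nu>"
      using borel[of D] by (auto simp: sets)
    ultimately obtain B where B: "B \<subseteq> UNIV - D" "measure_atom \<nu> B"
      using discrete unfolding discrete_measure_def by (meson not_gr_zero)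
    obtain t where "t \<in> B" "emeasure \<nu> {t} > 0"
      using atom_contains_point_mass[OF reg B(2)] .
    then show False
      using B(1) by (auto simp: D_def emeasure_eq_measure)
  qed
  \<comment> \<open>Initial segments of an enumeration of \<open>D\<close>: finite because the index
    is injective on \<open>D\<close>, and with union \<open>D\<close>.\<close>
  define G where "G n = {t \<in> D. to_nat_on D t < n}" for n
  have "finite (G n)" for n
  proof (rule inj_on_finite[where B = "{..<n}"])
    show "inj_on (to_nat_on D) (G n)"
      using inj_on_to_nat_on[OF \<open>countable D\<close>] by (rule inj_on_subset) (auto simp: G_def)
  qed (auto simp: G_def)
  \<comment> \<open>Continuity from above, available because \<open>\<nu>\<close> is finite.\<close>
  have "(\<lambda>n. emeasure \<nu> (UNIV - G n)) \<longlonglongrightarrow> emeasure \<nu> (\<Inter>n. UNIV - G n)"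
    using borel[of "G _"]
    by (intro Lim_emeasure_decseq) (auto simp: sets decseq_def G_def)
  also have "(\<Inter>n. UNIV - G n) = UNIV - D"
    by (auto simp: G_def)
  finally have "\<forall>\<^sub>F n in sequentially. emeasure \<nu> (UNIV - G n) < d"
    using \<open>0 < d\<close> by (intro order_tendstoD) (auto simp: null)
  then obtain n where "emeasure \<nu> (UNIV - G n) < d"
    by (auto simp: eventually_sequentially)
  then show ?thesis
    using that \<open>finite (G n)\<close> by blast
qed

section \<open>Approximating integrals by point masses\<close>

text \<open>Countable additivity for the family of empty sets gives a convergent series with
  constant terms, which must vanish.\<close>

lemma rcabv_empty:
  assumes "rcabv \<mu>"
  shows "\<mu> {} = 0"
proof -
  have "(\<lambda>n::nat. \<mu> {}) sums \<mu> (\<Union>n::nat. {})"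
    using assms[unfolded rcabv_def, THEN conjunct1, rule_format, of "\<lambda>_. {}"]
    by (auto simp: disjoint_family_on_def)
  then show ?thesis
    using summable_LIMSEQ_zero[OF sums_summable, of "\<lambda>_. \<mu> {}"] by (simp add: LIMSEQ_const_iff)
qed

lemma rcabv_Un:
  assumes "rcabv \<mu>" "A \<in> sets borel" "B \<in> sets borel" "A \<inter> B = {}"
  shows "\<mu> (A \<union> B) = \<mu> A + \<mu> B"
proof -
  have "range (binaryset A B) \<subseteq> sets borel" "disjoint_family (binaryset A B)"
    using assms by (auto simp: binaryset_def disjoint_family_on_def)
  then have "(\<lambda>n. \<mu> (binaryset A B n)) sums \<mu> (\<Union>n. binaryset A B n)"
    using assms(1) unfolding rcabv_def by blast
  moreover have "(\<lambda>n. \<mu> (binaryset A B n)) sums (\<mu> A + \<mu> B)"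
    using binaryset_sums[of \<mu> A B] rcabv_empty[OF assms(1)] by blast
  ultimately show ?thesis
    using sums_unique2 by (auto simp: UN_binaryset_eq)
qed

lemma rcabv_finite:
  fixes \<mu> :: "'k::t2_space set \<Rightarrow> 'z::real_normed_vector"
  assumes "rcabv \<mu>" "finite F"
  shows "\<mu> F = (\<Sum>t\<in>F. \<mu> {t})"
  using assms(2)
proof (induction F)
  case (insert t F)
  then show ?case
    using rcabv_Un[OF assms(1), of "{t}" F] finite_imp_closed[of F] by simp
qed (simp add: rcabv_empty[OF assms(1)])

text \<open>The variation ranges over partitions as sets of sets, whereas an indexed family may
  repeat a member. In a disjoint family a repeated member is empty and contributes zero.\<close>

lemma sum_norm_le_variation:
  assumes "finite I" "\<And>i. i \<in> I \<Longrightarrow> A i \<in> sets borel" "disjoint_family_on A I" "(\<Union>i\<in>I. A i) = E"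
    and "\<mu> {} = 0"
  shows "(\<Sum>i\<in>I. ennreal (norm (\<mu> (A i)))) \<le> variation \<mu> E"
proof -
  have "\<mu> (A i) = 0" if "i \<in> I" "j \<in> I" "i \<noteq> j" "A i = A j" for i j
    using assms(3,5) that by (metis disjoint_family_onD inf.idem)
  then have "(\<Sum>i\<in>I. ennreal (norm (\<mu> (A i)))) = (\<Sum>B\<in>A ` I. ennreal (norm (\<mu> B)))"
    using assms(1) by (subst sum.reindex_nontrivial) auto
  also have "\<dots> \<le> variation \<mu> E"
    unfolding variation_def
    using assms disjoint_family_on_disjoint_image[OF assms(3)]
    by (intro SUP_upper) auto
  finally show ?thesis .
qed

text \<open>Each level set of \<open>s\<close> splits into its points in \<open>F\<close> and the
  rest. The points reproduce the finite sum, and the rests partition \<open>UNIV - F\<close>, where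
  the variation is at most \<open>c\<close>.\<close>

lemma simple_vint_approx:
  fixes \<mu> :: "'k::t2_space set \<Rightarrow> 'x::real_normed_vector \<Rightarrow>\<^sub>L 'z::real_normed_vector"
  assumes \<mu>: "rcabv \<mu>" and s: "simple_borel s" and F: "finite F"
    and M: "\<And>t. norm (s t) \<le> M" and c: "variation \<mu> (UNIV - F) \<le> ennreal c" "0 \<le> c"
  shows "norm (simple_vint \<mu> s - (\<Sum>t\<in>F. \<mu> {t} (s t))) \<le> M * c"
proof -
  define B where "B v = s -` {v} - F" for v
  have fin: "finite (range s)" and meas: "s -` {v} \<in> sets borel" for v
    using s by (auto simp: simple_borel_def)
  have closed: "closed G" if "G \<subseteq> F" for G
    using that F finite_subset finite_imp_closed by blast
  have B: "B v \<in> sets borel" for v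
    unfolding B_def using meas closed[of F] by (intro sets.Diff) auto
  have "0 \<le> M"
    using order_trans[OF norm_ge_zero M] .
  have split: "\<mu> (s -` {v}) v = \<mu> (B v) v + (\<Sum>t\<in>{t\<in>F. s t = v}. \<mu> {t} (s t))" for v
  proof -
    have "s -` {v} = B v \<union> {t\<in>F. s t = v}"
      by (auto simp: B_def)
    then have "\<mu> (s -` {v}) = \<mu> (B v) + \<mu> {t\<in>F. s t = v}"
      using rcabv_Un[OF \<mu> B[of v], of "{t\<in>F. s t = v}"] closed[of "{t\<in>F. s t = v}"]
      by (auto simp: B_def)
    also have "\<mu> {t\<in>F. s t = v} = (\<Sum>t\<in>{t\<in>F. s t = v}. \<mu> {t})"
      using F by (intro rcabv_finite[OF \<mu>]) auto
    finally show ?thesis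
      by (auto simp: blinfun.add_left blinfun.sum_left)
  qed
  have "simple_vint \<mu> s - (\<Sum>t\<in>F. \<mu> {t} (s t)) = (\<Sum>v\<in>range s. \<mu> (B v) v)"
  proof -
    \<comment> \<open>The points of \<open>F\<close> are grouped by the value of
      \<open>s\<close>.\<close>
    have "(\<Sum>v\<in>range s. \<Sum>t\<in>{t\<in>F. s t = v}. \<mu> {t} (s t)) = (\<Sum>t\<in>F. \<mu> {t} (s t))"
      by (rule sum.group[OF F fin]) auto
    then show ?thesis
      unfolding simple_vint_def split sum.distrib by simp
  qed
  also have "norm \<dots> \<le> (\<Sum>v\<in>range s. norm (\<mu> (B v)) * M)"
  proof (rule sum_norm_le)
    fix v assume "v \<in> range s"
    then have "norm v \<le> M" using M by auto
    then show "norm (\<mu> (B v) v) \<le> norm (\<mu> (B v)) * M"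
      by (meson mult_left_mono norm_blinfun norm_ge_zero order_trans)
  qed
  also have "\<dots> = M * (\<Sum>v\<in>range s. norm (\<mu> (B v)))"
    by (simp add: sum_distrib_left mult.commute)
  also have "\<dots> \<le> M * c"
  proof (rule mult_left_mono[OF _ \<open>0 \<le> M\<close>])
    have "(\<Sum>v\<in>range s. ennreal (norm (\<mu> (B v)))) \<le> variation \<mu> (UNIV - F)"
      using fin B by (intro sum_norm_le_variation rcabv_empty[OF \<mu>])
        (auto simp: disjoint_family_on_def B_def)
    then have "ennreal (\<Sum>v\<in>range s. norm (\<mu> (B v))) \<le> ennreal c"
      using c(1) by (simp add: order_trans)
    then show "(\<Sum>v\<in>range s. norm (\<mu> (B v))) \<le> c"
      using c(2) by simp
  qed
  finally show ?thesis .
qed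

text \<open>The estimate passes to the limit of simple functions. These are bounded only by
  \<open>M + e\<close>, and only eventually, so \<open>e\<close> is sent to zero at the end.\<close>

lemma has_vint_approx:
  fixes \<mu> :: "'k::t2_space set \<Rightarrow> 'x::real_normed_vector \<Rightarrow>\<^sub>L 'z::real_normed_vector"
  assumes \<mu>: "rcabv \<mu>" and I: "has_vint \<mu> f I" and F: "finite F"
    and M: "\<And>t. norm (f t) \<le> M" and c: "variation \<mu> (UNIV - F) \<le> ennreal c" "0 \<le> c"
  shows "norm (I - (\<Sum>t\<in>F. \<mu> {t} (f t))) \<le> M * c"
proof -
  obtain s where s: "\<And>n. simple_borel (s n)" and unif: "uniform_limit UNIV s f sequentially"
    and lim: "(\<lambda>n. simple_vint \<mu> (s n)) \<longlonglongrightarrow> I"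
    using I unfolding has_vint_def by blast
  have "(\<lambda>n. norm (simple_vint \<mu> (s n) - (\<Sum>t\<in>F. \<mu> {t} (s n t)))) \<longlonglongrightarrow>
      norm (I - (\<Sum>t\<in>F. \<mu> {t} (f t)))"
    using lim tendsto_uniform_limitI[OF unif] by (intro tendsto_intros) auto
  moreover have "\<forall>\<^sub>F n in sequentially.
      norm (simple_vint \<mu> (s n) - (\<Sum>t\<in>F. \<mu> {t} (s n t))) \<le> (M + e) * c" if "0 < e" for e
    using uniform_limitD[OF unif that]
  proof eventually_elim
    case (elim n)
    have "norm (s n t) \<le> M + e" for t
      using bspec[OF elim, of t] M[of t] norm_triangle_sub[of "s n t" "f t"]
      by (simp add: dist_norm)
    then show ?case
      by (intro simple_vint_approx \<mu> s F c)
  qed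
  ultimately have le: "norm (I - (\<Sum>t\<in>F. \<mu> {t} (f t))) \<le> (M + e) * c" if "0 < e" for e
    using that by (intro tendsto_upperbound) auto
  have "((\<lambda>e. (M + e) * c) \<longlongrightarrow> (M + 0) * c) (at_right 0)"
    by (intro tendsto_intros)
  moreover have "\<forall>\<^sub>F e in at_right 0. norm (I - (\<Sum>t\<in>F. \<mu> {t} (f t))) \<le> (M + e) * c"
    using le unfolding eventually_at_right_field by (intro exI[of _ 1]) simp
  ultimately have "norm (I - (\<Sum>t\<in>F. \<mu> {t} (f t))) \<le> (M + 0) * c"
    by (rule tendsto_lowerbound) simp
  then show ?thesis by simp
qed

section \<open>Operators on spaces of continuous functions\<close>

lemma limited_set_image:
  fixes S :: "'a::real_normed_vector \<Rightarrow>\<^sub>L 'b::real_normed_vector"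
  assumes "limited_set A"
  shows "limited_set (S ` A)"
  unfolding limited_set_def
proof (intro conjI allI impI)
  show "bounded (S ` A)"
    using assms bounded_linear_image[OF _ blinfun.bounded_linear_right]
    by (auto simp: limited_set_def)
  fix \<phi> :: "nat \<Rightarrow> 'b dual" assume "\<forall>y. (\<lambda>n. \<phi> n y) \<longlonglongrightarrow> 0"
  \<comment> \<open>Composition with \<open>S\<close> pulls a w*-null sequence back to a w*-null
    sequence with the same suprema.\<close>
  then show "(\<lambda>n. SUP y\<in>S ` A. ennreal \<bar>\<phi> n y\<bar>) \<longlonglongrightarrow> 0"
    using assms[unfolded limited_set_def, THEN conjunct2, rule_format, of "\<lambda>n. \<phi> n o\<^sub>L S"]
    by (simp add: image_comp o_def)
qed

lemma weakly_null_image: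
  fixes S :: "'a::real_normed_vector \<Rightarrow>\<^sub>L 'b::real_normed_vector"
  assumes "weakly_null x"
  shows "weakly_null (\<lambda>n. S (x n))"
  unfolding weakly_null_def
proof
  fix \<phi> :: "'b dual"
  show "(\<lambda>n. \<phi> (S (x n))) \<longlonglongrightarrow> 0"
    using assms[unfolded weakly_null_def, rule_format, of "\<phi> o\<^sub>L S"] by simp
qed

lemma weakly_summable_image:
  fixes S :: "'a::real_normed_vector \<Rightarrow>\<^sub>L 'b::real_normed_vector"
  assumes "weakly_summable p x"
  shows "weakly_summable p (\<lambda>n. S (x n))"
  unfolding weakly_summable_def
proof
  fix \<phi> :: "'b dual"
  show "summable (\<lambda>n. \<bar>\<phi> (S (x n))\<bar> powr p)"
    using assms[unfolded weakly_summable_def, rule_format, of "\<phi> o\<^sub>L S"] by simp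
qed

definition evaluation :: "'k \<Rightarrow> ('k::topological_space \<Rightarrow>\<^sub>C 'x::real_normed_vector) \<Rightarrow>\<^sub>L 'x" where
  "evaluation t = Blinfun (\<lambda>f. apply_bcontfun f t)"

lemma evaluation_apply [simp]:
  fixes f :: "'k::topological_space \<Rightarrow>\<^sub>C 'x::real_normed_vector"
  shows "evaluation t f = f t"
proof -
  have "bounded_linear (\<lambda>f :: 'k \<Rightarrow>\<^sub>C 'x. apply_bcontfun f t)"
    by (rule bounded_linear_intro[where K = 1]) (auto simp: norm_bounded)
  then show ?thesis
    by (simp add: evaluation_def bounded_linear_Blinfun_apply)
qed

section \<open>Controlling an operator by its point values\<close>

lemma variation_functional_measure_le:
  "norm \<phi> \<le> 1 \<Longrightarrow> variation (functional_measure \<phi> m) E \<le> semivariation m E"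
  unfolding semivariation_def by (rule SUP_upper) simp

text \<open>A functional norming \<open>T f\<close> reduces the vector estimate to its scalar
  measure, whose variation off \<open>F\<close> is dominated by the semivariation.\<close>

lemma norm_operator_le_point_values:
  fixes T :: "('k::t2_space \<Rightarrow>\<^sub>C 'x::real_normed_vector) \<Rightarrow>\<^sub>L 'y::real_normed_vector"
  assumes rep: "representing_measure m T" and F: "finite F"
    and S: "\<And>t. t \<in> F \<Longrightarrow> value_operator m {t} (S t)"
    and c: "semivariation m (UNIV - F) \<le> ennreal c" "0 \<le> c"
  shows "norm (T f) \<le> norm f * c + (\<Sum>t\<in>F. norm (S t (f t)))"
proof -
  obtain \<phi> :: "'y dual" where \<phi>: "norm \<phi> \<le> 1" "\<phi> (T f) = norm (T f)"
    using exists_norming_functional .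
  define \<mu> where "\<mu> = functional_measure \<phi> m"
  have \<mu>: "rcabv \<mu>" "has_vint \<mu> f (\<phi> (T f))"
    using rep unfolding representing_measure_def represents_functional_def \<mu>_def by auto
  have "norm (\<phi> (T f) - (\<Sum>t\<in>F. \<mu> {t} (f t))) \<le> norm f * c"
    using order_trans[OF variation_functional_measure_le[OF \<phi>(1)] c(1)]
    by (intro has_vint_approx \<mu> F c norm_bounded) (simp add: \<mu>_def)
  moreover have "\<bar>\<Sum>t\<in>F. \<mu> {t} (f t)\<bar> \<le> (\<Sum>t\<in>F. norm (S t (f t)))"
  proof (rule order_trans[OF sum_abs sum_mono])
    fix t assume "t \<in> F"
    \<comment> \<open>The value of \<open>m {t}\<close> at \<open>f t\<close> is the embedded vector
      \<open>S t (f t)\<close>, so evaluating it at \<open>\<phi>\<close> gives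
      \<open>\<phi> (S t (f t))\<close>.\<close>
    then have "\<mu> {t} (f t) = \<phi> (S t (f t))"
      using S[of t] by (simp add: \<mu>_def value_operator_def)
    also have "\<bar>\<dots>\<bar> \<le> norm \<phi> * norm (S t (f t))"
      using norm_blinfun[of \<phi> "S t (f t)"] by simp
    also have "\<dots> \<le> norm (S t (f t))"
      using mult_right_mono[OF \<phi>(1), of "norm (S t (f t))"] by simp
    finally show "\<bar>\<mu> {t} (f t)\<bar> \<le> norm (S t (f t))" .
  qed
  ultimately show ?thesis
    by (simp add: \<phi>(2))
qed

text \<open>Boundedness of the sequence makes the error off \<open>F\<close> small for all
  \<open>n\<close> at once, so \<open>F\<close> depends on \<open>e\<close> alone and only finitely
  many null sequences remain.\<close>

lemma operator_tendsto_zero_if_point_values: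
  fixes T :: "('k::t2_space \<Rightarrow>\<^sub>C 'x::real_normed_vector) \<Rightarrow>\<^sub>L 'y::real_normed_vector"
    and f :: "nat \<Rightarrow> 'k \<Rightarrow>\<^sub>C 'x"
  assumes rep: "representing_measure m T"
    and control: "control_measure \<nu> m" and discrete: "discrete_measure \<nu>"
    and bounded: "bounded (range f)"
    and S: "\<And>t. value_operator m {t} (S t)"
    and lim: "\<And>t. (\<lambda>n. S t (f n t)) \<longlonglongrightarrow> 0"
  shows "(\<lambda>n. T (f n)) \<longlonglongrightarrow> 0"
proof (rule tendstoI)
  fix e :: real assume "0 < e"
  obtain M where M: "0 < M" "\<And>n. norm (f n) \<le> M"
    using bounded unfolding bounded_pos by auto
  \<comment> \<open>Chosen so that \<open>M * c = e / 2\<close>; the other half of \<open>e\<close>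
    is left for the finite sum.\<close>
  define c where "c = e / (2 * M)"
  have "0 < c" using \<open>0 < e\<close> M by (simp add: c_def)
  then have "\<exists>d>0. \<forall>A\<in>sets borel. emeasure \<nu> A < d \<longrightarrow> semivariation m A < ennreal c"
    using control unfolding control_measure_def by simp
  then obtain d where d: "0 < d"
    "\<And>A. A \<in> sets borel \<Longrightarrow> emeasure \<nu> A < d \<Longrightarrow> semivariation m A < ennreal c"
    by blast
  obtain F where F: "finite F" "emeasure \<nu> (UNIV - F) < d"
    using discrete_measure_cofinite_small[OF _ discrete d(1)] control
    unfolding control_measure_def by blast
  have "UNIV - F \<in> sets borel"
    using finite_imp_closed[OF F(1)] by auto
  then have c: "semivariation m (UNIV - F) \<le> ennreal c"
    using d(2) F(2) by (simp add: less_imp_le)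
  have le: "norm (T (f n)) \<le> e / 2 + (\<Sum>t\<in>F. norm (S t (f n t)))" for n
  proof -
    have "norm (f n) * c \<le> e / 2"
      using mult_right_mono[OF M(2), of c n] M(1) \<open>0 < c\<close> by (simp add: c_def)
    then show ?thesis
      using norm_operator_le_point_values[OF rep F(1) S c, of "f n"] \<open>0 < c\<close> by simp
  qed
  have "(\<lambda>n. \<Sum>t\<in>F. norm (S t (f n t))) \<longlonglongrightarrow> 0"
    using lim by (intro tendsto_null_sum tendsto_norm_zero)
  then have "\<forall>\<^sub>F n in sequentially. (\<Sum>t\<in>F. norm (S t (f n t))) < e / 2"
    using \<open>0 < e\<close> by (intro order_tendstoD) auto
  then show "\<forall>\<^sub>F n in sequentially. dist (T (f n)) 0 < e"
  proof eventually_elim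
    case (elim n)
    then show ?case using le[of n] by simp
  qed
qed

theorem theorem17:
  fixes p :: real
    and T :: "('k::t2_space \<Rightarrow>\<^sub>C 'x::banach) \<Rightarrow>\<^sub>L 'y::banach"
    and m :: "'k set \<Rightarrow> 'x \<Rightarrow>\<^sub>L 'y dual dual"
    and \<nu> :: "'k measure"
  assumes "1 \<le> p"
    and "compact (UNIV :: 'k set)"
    and "representing_measure m T"
    and "strongly_bounded m"
    and "control_measure \<nu> m"
    and "discrete_measure \<nu>"
  shows "((\<forall>A\<in>sets borel. \<exists>S. value_operator m A S \<and> limited_completely_continuous S) \<longrightarrow>
            limited_completely_continuous T) \<and>
         ((\<forall>A\<in>sets borel. \<exists>S. value_operator m A S \<and> limited_p_convergent p S) \<longrightarrow>
            limited_p_convergent p T)"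
proof -
  \<comment> \<open>Common core of both claims: \<open>P\<close> stands for either class of
    operators, and \<open>lim\<close> is what membership in it yields along the values of
    \<open>f\<close> at a point.\<close>
  have T_null: "(\<lambda>n. T (f n)) \<longlonglongrightarrow> 0"
    if "\<forall>A\<in>sets borel. \<exists>S. value_operator m A S \<and> P S" "limited_set (range f)"
      and lim: "\<And>S t. P S \<Longrightarrow> limited_set (range (\<lambda>n. f n t)) \<Longrightarrow> (\<lambda>n. S (f n t)) \<longlonglongrightarrow> 0"
    for P and f :: "nat \<Rightarrow> 'k \<Rightarrow>\<^sub>C 'x"
  proof -
    \<comment> \<open>Singletons are closed in a Hausdorff space, hence Borel.\<close>
    have "\<forall>t. \<exists>S. value_operator m {t} S \<and> P S"
      using that(1) by simp
    then obtain S where "\<forall>t. value_operator m {t} (S t) \<and> P (S t)"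
      by (rule choice[THEN exE])
    then have S: "\<And>t. value_operator m {t} (S t)" "\<And>t. P (S t)"
      by simp_all
    have "limited_set (range (\<lambda>n. f n t))" for t
      using limited_set_image[OF that(2), of "evaluation t"] by (simp add: image_comp o_def)
    then show ?thesis
      using that(2) assms(3,5,6) S lim
      by (intro operator_tendsto_zero_if_point_values[where S = S and m = m and \<nu> = \<nu>])
        (auto simp: limited_set_def)
  qed
  have "limited_completely_continuous T"
    if "\<forall>A\<in>sets borel. \<exists>S. value_operator m A S \<and> limited_completely_continuous S"
    unfolding limited_completely_continuous_def
  proof (intro allI impI)
    fix f :: "nat \<Rightarrow> 'k \<Rightarrow>\<^sub>C 'x" assume f: "weakly_null f" "limited_set (range f)"
    \<comment> \<open>Weak nullity at each point comes from evaluation there; limitedness is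
      supplied inside \<open>T_null\<close>.\<close>
    show "(\<lambda>n. T (f n)) \<longlonglongrightarrow> 0"
      using weakly_null_image[OF f(1), of "evaluation _"]
      by (intro T_null[OF that f(2)]) (simp add: limited_completely_continuous_def)
  qed
  moreover have "limited_p_convergent p T"
    if "\<forall>A\<in>sets borel. \<exists>S. value_operator m A S \<and> limited_p_convergent p S"
    unfolding limited_p_convergent_def
  proof (intro allI impI)
    fix f :: "nat \<Rightarrow> 'k \<Rightarrow>\<^sub>C 'x" assume f: "weakly_summable p f" "limited_set (range f)"
    show "(\<lambda>n. T (f n)) \<longlonglongrightarrow> 0"
      using weakly_summable_image[OF f(1), of "evaluation _"]
      by (intro T_null[OF that f(2)]) (simp add: limited_p_convergent_def)
  qed
  ultimately show ?thesis by blast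
qed

end
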